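(* Every logic in $[\mathsf{KO}^-,\mathsf{CL}]$ lies in exactly one of the intervals $[\mathsf{LP},\mathsf{CL}]$, $[\mathsf{KO},\mathsf{K}]$, $[\mathsf{KO}^-,\mathsf{K}^-]$, and $[\mathsf{LP},\mathsf{CL}]=\{\mathsf{LP},\mathsf{LP}\vee\mathsf{ECQ},\mathsf{CL}\}$, $[\mathsf{KO},\mathsf{K}]=\{\mathsf{KO},\mathsf{KO}\vee\mathsf{ECQ},\mathsf{K}\}$, $[\mathsf{KO}^-,\mathsf{K}^-]=\{\mathsf{KO}^-,\mathsf{KO}^-\vee\mathsf{ECQ},\mathsf{K}^-\}$.
   Context: Formulas are built from a countably infinite set of variables using $\wedge,\vee$, ${\sim}$, $\top,\bot$. A logic is a set of rules $\Gamma\vdash\varphi$ closed under reflexivity, monotonicity, cut and substitution; $\le$ is inclusion, $L_1\vee L_2$ the least logic containing both, $[L_1,L_2]=\{L:L_1\le L\le L_2\}$; the extension of a logic by rules is the least logic containing both. For a matrix, a rule is valid if every valuation sending the premises into the designated set sends the conclusion there; $\mathrm{Log}$ is the set of valid rules. Let $\mathbf{DM}_4$ be the De Morgan algebra on $\{\bot,n,b,\top\}$ with $\bot<n,b<\top$ ($n,b$ incomparable), ${\sim}$ swapping $\top,\bot$ and fixing $n,b$. $\mathsf{BD}=\mathrm{Log}\langle\mathbf{DM}_4,\{b,\top\}\rangle$, $\mathsf{K}=\mathrm{Log}\langle\{\bot,n,\top\},\{\top\}\rangle$, $\mathsf{LP}=\mathrm{Log}\langle\{\bot,b,\top\},\{b,\top\}\rangle$,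 $\mathsf{CL}=\mathrm{Log}\langle\{\bot,\top\},\{\top\}\rangle$, $\mathsf{KO}=\mathsf{LP}\cap\mathsf{K}$; $\mathsf{ECQ}$ is the extension of $\mathsf{BD}$ by $p,{\sim}p\vdash q$. $\mathsf{K}^-$ is $\mathrm{Log}$ of the matrix: let $P=\{u,v,u',v'\}$ be the poset whose only strict order relations are $u<u'$, $u<v'$, $v<u'$, with involution $\partial$ swapping $u\leftrightarrow u'$, $v\leftrightarrow v'$; the algebra consists of upsets of $P$ with $\cap,\cup$, $\bot=\emptyset$, $\top=P$, ${\sim}U=P\setminus\partial[U]$, designated set $\{P\}$. $\mathsf{KO}^-=\mathsf{LP}\cap\mathsf{K}^-$. *)

theory Defs
  imports Main
begin

datatype fm =
    Var nat
  | Top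
  | Bot
  | Neg fm
  | Conj fm fm
  | Disj fm fm

primrec subst :: "(nat \<Rightarrow> fm) \<Rightarrow> fm \<Rightarrow> fm" where
  "subst s (Var x) = s x"
| "subst s Top = Top"
| "subst s Bot = Bot"
| "subst s (Neg a) = Neg (subst s a)"
| "subst s (Conj a b) = Conj (subst s a) (subst s b)"
| "subst s (Disj a b) = Disj (subst s a) (subst s b)"

text \<open>The premise set of a rule may be infinite, and so logics need not be finitary.\<close>

type_synonym rule = "fm set \<times> fm"

definition is_logic :: "rule set \<Rightarrow> bool" where
  "is_logic L \<longleftrightarrow>
     (\<forall>a. ({a}, a) \<in> L) \<and>
     (\<forall>G D a. (G, a) \<in> L \<longrightarrow> (G \<union> D, a) \<in> L) \<and>
     (\<forall>G D a. (\<forall>d\<in>D. (G, d) \<in> L) \<longrightarrow> (G \<union> D, a) \<in> L \<longrightarrow> (G, a) \<in> L) \<and>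
     (\<forall>s G a. (G, a) \<in> L \<longrightarrow> (subst s ` G, subst s a) \<in> L)"

definition least_logic :: "rule set \<Rightarrow> rule set" where
  "least_logic R = \<Inter>{L. is_logic L \<and> R \<subseteq> L}"

definition logic_extension :: "rule set \<Rightarrow> rule set \<Rightarrow> rule set" where
  "logic_extension L R = least_logic (L \<union> R)"

definition logic_join :: "rule set \<Rightarrow> rule set \<Rightarrow> rule set"  (infixl \<open>\<squnion>\<^sub>L\<close> 65) where
  "L1 \<squnion>\<^sub>L L2 = least_logic (L1 \<union> L2)"

definition logic_interval :: "rule set \<Rightarrow> rule set \<Rightarrow> rule set set" where
  "logic_interval L1 L2 = {L. is_logic L \<and> L1 \<subseteq> L \<and> L \<subseteq> L2}"

record 'a matrix =
  m_carrier :: "'a set"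
  m_meet :: "'a \<Rightarrow> 'a \<Rightarrow> 'a"
  m_join :: "'a \<Rightarrow> 'a \<Rightarrow> 'a"
  m_neg :: "'a \<Rightarrow> 'a"
  m_bot :: 'a
  m_top :: 'a
  m_desig :: "'a set"

primrec m_eval :: "'a matrix \<Rightarrow> (nat \<Rightarrow> 'a) \<Rightarrow> fm \<Rightarrow> 'a" where
  "m_eval M v (Var x) = v x"
| "m_eval M v Top = m_top M"
| "m_eval M v Bot = m_bot M"
| "m_eval M v (Neg a) = m_neg M (m_eval M v a)"
| "m_eval M v (Conj a b) = m_meet M (m_eval M v a) (m_eval M v b)"
| "m_eval M v (Disj a b) = m_join M (m_eval M v a) (m_eval M v b)"

definition m_valid :: "'a matrix \<Rightarrow> rule \<Rightarrow> bool" where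
  "m_valid M r \<longleftrightarrow>
     (\<forall>v. range v \<subseteq> m_carrier M \<longrightarrow>
       m_eval M v ` fst r \<subseteq> m_desig M \<longrightarrow> m_eval M v (snd r) \<in> m_desig M)"

definition Log :: "'a matrix \<Rightarrow> rule set" where
  "Log M = {r. m_valid M r}"

datatype dm4 = dm_bot | dm_n | dm_b | dm_top

instantiation dm4 :: bounded_lattice
begin

definition "bot = dm_bot"
definition "top = dm_top"
definition "x \<le> y \<longleftrightarrow> x = y \<or> x = dm_bot \<or> y = dm_top" for x y :: dm4
definition "x < y \<longleftrightarrow> x \<le> y \<and> x \<noteq> y" for x y :: dm4
definition "inf x y = (if x \<le> y then x else if y \<le> x then y else dm_bot)" for x y :: dm4
definition "sup x y = (if x \<le> y then y else if y \<le> x then x else dm_top)" for x y :: dm4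

instance
proof
  fix x y z :: dm4
  note defs = bot_dm4_def top_dm4_def less_eq_dm4_def less_dm4_def inf_dm4_def sup_dm4_def
  show "x < y \<longleftrightarrow> x \<le> y \<and> \<not> y \<le> x" by (cases x; cases y; cases z; simp add: defs)
  show "x \<le> x" by (cases x; cases y; cases z; simp add: defs)
  show "x \<le> y \<Longrightarrow> y \<le> z \<Longrightarrow> x \<le> z" by (cases x; cases y; cases z; simp add: defs)
  show "x \<le> y \<Longrightarrow> y \<le> x \<Longrightarrow> x = y" by (cases x; cases y; cases z; simp add: defs)
  show "inf x y \<le> x" by (cases x; cases y; cases z; simp add: defs)
  show "inf x y \<le> y" by (cases x; cases y; cases z; simp add: defs)
  show "x \<le> y \<Longrightarrow> x \<le> z \<Longrightarrow> x \<le> inf y z" by (cases x; cases y; cases z; simp add: defs)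
  show "x \<le> sup x y" by (cases x; cases y; cases z; simp add: defs)
  show "y \<le> sup x y" by (cases x; cases y; cases z; simp add: defs)
  show "y \<le> x \<Longrightarrow> z \<le> x \<Longrightarrow> sup y z \<le> x" by (cases x; cases y; cases z; simp add: defs)
  show "bot \<le> x" by (cases x; cases y; cases z; simp add: defs)
  show "x \<le> top" by (cases x; cases y; cases z; simp add: defs)
qed

end

primrec dm_neg :: "dm4 \<Rightarrow> dm4" where
  "dm_neg dm_bot = dm_top"
| "dm_neg dm_n = dm_n"
| "dm_neg dm_b = dm_b"
| "dm_neg dm_top = dm_bot"

definition dm_matrix :: "dm4 set \<Rightarrow> dm4 set \<Rightarrow> dm4 matrix" where
  "dm_matrix A D = \<lparr>m_carrier = A, m_meet = inf, m_join = sup, m_neg = dm_neg,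
     m_bot = bot, m_top = top, m_desig = D\<rparr>"

definition BD :: "rule set" where
  "BD = Log (dm_matrix UNIV {dm_b, dm_top})"

definition K :: "rule set" where
  "K = Log (dm_matrix {dm_bot, dm_n, dm_top} {dm_top})"

definition LP :: "rule set" where
  "LP = Log (dm_matrix {dm_bot, dm_b, dm_top} {dm_b, dm_top})"

definition CL :: "rule set" where
  "CL = Log (dm_matrix {dm_bot, dm_top} {dm_top})"

definition KO :: "rule set" where
  "KO = LP \<inter> K"

definition ECQ :: "rule set" where
  "ECQ = logic_extension BD {({Var 0, Neg (Var 0)}, Var 1)}"

datatype pt = pt_u | pt_v | pt_u' | pt_v'

instantiation pt :: order
begin

definition "x < y \<longleftrightarrow> (x, y) \<in> {(pt_u, pt_u'), (pt_u, pt_v'), (pt_v, pt_u')}" for x y :: pt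
definition "x \<le> y \<longleftrightarrow> x < y \<or> x = y" for x y :: pt

instance
  by standard (auto simp: less_pt_def less_eq_pt_def)

end

primrec pt_inv :: "pt \<Rightarrow> pt" where
  "pt_inv pt_u = pt_u'"
| "pt_inv pt_u' = pt_u"
| "pt_inv pt_v = pt_v'"
| "pt_inv pt_v' = pt_v"

definition pt_upsets :: "pt set set" where
  "pt_upsets = {U. \<forall>x\<in>U. \<forall>y. x \<le> y \<longrightarrow> y \<in> U}"

definition K_minus_matrix :: "pt set matrix" where
  "K_minus_matrix = \<lparr>m_carrier = pt_upsets, m_meet = (\<inter>), m_join = (\<union>),
     m_neg = (\<lambda>U. UNIV - pt_inv ` U), m_bot = {}, m_top = UNIV, m_desig = {UNIV}\<rparr>"

definition K_minus :: "rule set" where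
  "K_minus = Log K_minus_matrix"

definition KO_minus :: "rule set" where
  "KO_minus = LP \<inter> K_minus"

lemma is_logic_refl: "is_logic L \<Longrightarrow> ({a}, a) \<in> L"
  unfolding is_logic_def by (elim conjE) (erule spec)

lemma is_logic_mono: "is_logic L \<Longrightarrow> (G, a) \<in> L \<Longrightarrow> (G \<union> D, a) \<in> L"
  unfolding is_logic_def by (elim conjE) iprover

lemma is_logic_cut:
  "is_logic L \<Longrightarrow> (\<And>d. d \<in> D \<Longrightarrow> (G, d) \<in> L) \<Longrightarrow> (G \<union> D, a) \<in> L \<Longrightarrow> (G, a) \<in> L"
  unfolding is_logic_def Ball_def by (elim conjE) iprover

lemma is_logic_subst: "is_logic L \<Longrightarrow> (G, a) \<in> L \<Longrightarrow> (subst s ` G, subst s a) \<in> L"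
  unfolding is_logic_def by (elim conjE) iprover

lemma least_logic_iff:
  "r \<in> least_logic R \<longleftrightarrow> (\<forall>L. is_logic L \<longrightarrow> R \<subseteq> L \<longrightarrow> r \<in> L)"
  by (auto simp: least_logic_def)

lemma is_logic_least_logic: "is_logic (least_logic R)"
  unfolding is_logic_def
proof (intro conjI allI impI)
  show "({a}, a) \<in> least_logic R" for a
    unfolding least_logic_iff by (iprover intro: is_logic_refl)
  show "(G \<union> D, a) \<in> least_logic R" if "(G, a) \<in> least_logic R" for G D a
    using that unfolding least_logic_iff by (iprover intro: is_logic_mono)
  show "(G, a) \<in> least_logic R"
    if prems: "\<forall>d\<in>D. (G, d) \<in> least_logic R" "(G \<union> D, a) \<in> least_logic R" for G D a
    unfolding least_logic_iff
  proof (intro allI impI)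
    fix L assume L: "is_logic L" "R \<subseteq> L"
    from L prems(2) have "(G \<union> D, a) \<in> L" unfolding least_logic_iff by iprover
    moreover have "(G, d) \<in> L" if "d \<in> D" for d
      using L bspec[OF prems(1) that] unfolding least_logic_iff by iprover
    ultimately show "(G, a) \<in> L" using is_logic_cut[OF L(1)] by iprover
  qed
  show "(subst s ` G, subst s a) \<in> least_logic R" if "(G, a) \<in> least_logic R" for s G a
    using that unfolding least_logic_iff by (iprover intro: is_logic_subst)
qed

lemma least_logic_upper: "R \<subseteq> least_logic R"
  by (auto simp: least_logic_def)

lemma least_logic_least: "is_logic L \<Longrightarrow> R \<subseteq> L \<Longrightarrow> least_logic R \<subseteq> L"
  by (auto simp: least_logic_def)

lemma pt_upsets_neg: "U \<in> pt_upsets \<Longrightarrow> UNIV - pt_inv ` U \<in> pt_upsets"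
proof -
  assume U: "U \<in> pt_upsets"
  have inv: "pt_inv (pt_inv x) = x" for x by (cases x) auto
  have anti: "x \<le> y \<Longrightarrow> pt_inv y \<le> pt_inv x" for x y
    by (auto simp: less_eq_pt_def less_pt_def)
  show ?thesis
    unfolding pt_upsets_def
  proof (intro CollectI ballI allI impI)
    fix x y assume x: "x \<in> UNIV - pt_inv ` U" and xy: "x \<le> y"
    have "y \<notin> pt_inv ` U"
    proof
      assume "y \<in> pt_inv ` U"
      then have "pt_inv y \<in> U" by (auto simp: inv)
      with U anti[OF xy] have "pt_inv x \<in> U" by (auto simp: pt_upsets_def)
      then have "x \<in> pt_inv ` U" by (metis inv image_eqI)
      with x show False by blast
    qed
    then show "y \<in> UNIV - pt_inv ` U" by blast
  qed
qed

end

theory Submission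
  imports Defs
begin

text \<open>
  If a rule of \<open>L\<close> fails in a matrix under some valuation, then substituting for every variable a
  term that takes the same value produces an instance in at most two variables which still
  witnesses the failure. Modulo \<open>KO_minus\<close> this instance yields a single
  characteristic rule: excluded middle for \<open>K\<close>, the Kleene rule for \<open>K_minus\<close>, explosion for
  \<open>LP\<close>, and disjunctive syllogism for \<open>LP\<close> together with a classically satisfiable premise set.
  Over the bottom of its interval each of these rules axiomatizes the logic in question; infinite
  premise sets are handled by the compactness of finite matrices.
\<close>

section \<open>Compactness of finite matrices\<close>

primrec fm_vars :: "fm \<Rightarrow> nat set" where
  "fm_vars (Var x) = {x}"
| "fm_vars Top = {}"
| "fm_vars Bot = {}"
| "fm_vars (Neg a) = fm_vars a"
| "fm_vars (Conj a b) = fm_vars a \<union> fm_vars b"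
| "fm_vars (Disj a b) = fm_vars a \<union> fm_vars b"

lemma finite_fm_vars: "finite (fm_vars a)"
  by (induction a) auto

lemma m_eval_cong: "(\<And>x. x \<in> fm_vars a \<Longrightarrow> v x = w x) \<Longrightarrow> m_eval M v a = m_eval M w a"
  by (induction a) auto

lemma m_eval_subst: "m_eval M v (subst s a) = m_eval M (\<lambda>x. m_eval M v (s x)) a"
  by (induction a) auto

definition finitary :: "rule set \<Rightarrow> bool" where
  "finitary L \<longleftrightarrow> (\<forall>G a. (G, a) \<in> L \<longrightarrow> (\<exists>G0\<subseteq>G. finite G0 \<and> (G0, a) \<in> L))"

text \<open>Koenig's lemma on partial valuations: values are fixed one variable at a time so that
  every finite set of premises stays refutable by a valuation extending the prefix. The limit of the
  prefixes then refutes the whole rule.\<close>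

lemma finitary_Log:
  assumes fin: "finite (m_carrier M)"
  shows "finitary (Log M)"
  unfolding finitary_def
proof (intro allI impI, rule ccontr)
  fix G a
  assume "(G, a) \<in> Log M" and "\<not> (\<exists>G0\<subseteq>G. finite G0 \<and> (G0, a) \<in> Log M)"
  then have unprovable: "\<And>G0. G0 \<subseteq> G \<Longrightarrow> finite G0 \<Longrightarrow> (G0, a) \<notin> Log M"
    by blast
  define refutes where "refutes v G0 \<longleftrightarrow>
    range v \<subseteq> m_carrier M \<and> m_eval M v ` G0 \<subseteq> m_desig M \<and> m_eval M v a \<notin> m_desig M" for v G0
  define good where "good n u \<longleftrightarrow>
    (\<forall>G0. G0 \<subseteq> G \<longrightarrow> finite G0 \<longrightarrow> (\<exists>v. refutes v G0 \<and> (\<forall>i<n. v i = u i)))" for n u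
  have good_0: "good 0 u" for u
    using unprovable by (auto simp: good_def refutes_def Log_def m_valid_def)
  have good_Suc: "\<exists>c\<in>m_carrier M. good (Suc n) (u(n := c))" if good: "good n u" for n u
  proof (rule ccontr)
    assume "\<not> ?thesis"
    then have "\<forall>c\<in>m_carrier M. \<exists>G0. G0 \<subseteq> G \<and> finite G0 \<and>
        \<not> (\<exists>v. refutes v G0 \<and> (\<forall>i<Suc n. v i = (u(n := c)) i))"
      by (simp add: good_def)
    from bchoice[OF this] obtain H where H: "\<forall>c\<in>m_carrier M. H c \<subseteq> G \<and> finite (H c) \<and>
        \<not> (\<exists>v. refutes v (H c) \<and> (\<forall>i<Suc n. v i = (u(n := c)) i))"
      by (elim exE)
    \<comment> \<open>Were each value \<open>c\<close> at \<open>n\<close> blocked by a finite set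
      \<open>H c\<close>, the union of these sets would be finite too, as the carrier is finite. A
      valuation refuting the union takes some value at \<open>n\<close>, which is then not
      blocked.\<close>
    have "(\<Union>c\<in>m_carrier M. H c) \<subseteq> G" "finite (\<Union>c\<in>m_carrier M. H c)"
      using H fin by auto
    with good obtain v where v: "refutes v (\<Union>c\<in>m_carrier M. H c)" "\<forall>i<n. v i = u i"
      unfolding good_def by blast
    from v(1) have c: "v n \<in> m_carrier M" by (auto simp: refutes_def)
    with v(1) have "refutes v (H (v n))" unfolding refutes_def by blast
    moreover have "\<forall>i<Suc n. v i = (u(n := v n)) i" using v(2) by (auto simp: less_Suc_eq)
    ultimately show False using bspec[OF H c] by blast
  qed
  obtain f where good_f: "\<And>n. good n (f n)"
    and f_Suc: "\<And>n. \<exists>c\<in>m_carrier M. f (Suc n) = (f n)(n := c)"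
  proof -
    have "\<exists>f. \<forall>n. good n (f n) \<and> (\<exists>c\<in>m_carrier M. f (Suc n) = (f n)(n := c))"
      by (rule dependent_nat_choice) (use good_0 good_Suc in blast)+
    then show thesis using that by blast
  qed
  \<comment> \<open>Only the values of \<open>f n\<close> below \<open>n\<close> are settled. The
    value at \<open>n\<close> is settled in passing to \<open>f (Suc n)\<close> and kept from then
    on.\<close>
  define w where "w n = f (Suc n) n" for n
  have w_f: "f n i = w i" if "i < n" for n i
    using that
  proof (induction n)
    case (Suc n)
    obtain c where "f (Suc n) = (f n)(n := c)" using f_Suc by blast
    with Suc show ?case by (cases "i = n") (auto simp: w_def)
  qed simp
  have range_w: "range w \<subseteq> m_carrier M"
  proof
    fix y assume "y \<in> range w"
    then obtain n where "y = f (Suc n) n" by (auto simp: w_def)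
    with f_Suc[of n] show "y \<in> m_carrier M" by auto
  qed
  have step: "m_eval M w ` G0 \<subseteq> m_desig M \<and> m_eval M w a \<notin> m_desig M"
    if G0: "G0 \<subseteq> G" "finite G0" for G0
  proof -
    have "finite (\<Union>(fm_vars ` insert a G0))" using G0(2) by (simp add: finite_fm_vars)
    then obtain n where n: "\<And>i. i \<in> \<Union>(fm_vars ` insert a G0) \<Longrightarrow> i < n"
      using finite_nat_set_iff_bounded by meson
    obtain v where v: "refutes v G0" "\<forall>i<n. v i = f n i"
      using good_f[of n, unfolded good_def, rule_format, OF G0] by (elim exE conjE)
    have "m_eval M v b = m_eval M w b" if "b \<in> insert a G0" for b
    proof (rule m_eval_cong)
      fix x assume "x \<in> fm_vars b"
      with that n have "x < n" by blast
      with v(2) w_f show "v x = w x" by simp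
    qed
    with v(1) show ?thesis by (auto simp: refutes_def)
  qed
  have "m_eval M w ` G \<subseteq> m_desig M"
    using step[of "{g}" for g] by blast
  with step[of "{}"] range_w \<open>(G, a) \<in> Log M\<close> show False
    by (auto simp: Log_def m_valid_def)
qed

section \<open>Evaluation in the four-element algebra\<close>

text \<open>The four values are coded by two independent bits, \<open>dm_b\<close> being both true
  and false and \<open>dm_n\<close> neither. Negation swaps the bits and the lattice operations act
  on them classically, so questions about values become propositional.\<close>

definition dm_true :: "dm4 \<Rightarrow> bool" where
  "dm_true x \<longleftrightarrow> x = dm_b \<or> x = dm_top"

definition dm_false :: "dm4 \<Rightarrow> bool" where
  "dm_false x \<longleftrightarrow> x = dm_b \<or> x = dm_bot"

lemmas dm_defs = dm_true_def dm_false_def bot_dm4_def top_dm4_def less_eq_dm4_def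
  inf_dm4_def sup_dm4_def

lemma dm_eq_iff: "x = y \<longleftrightarrow> dm_true x = dm_true y \<and> dm_false x = dm_false y"
  by (cases x; cases y; simp add: dm_defs)

lemma dm_true_simps [simp]:
  "dm_true dm_bot = False" "dm_true dm_n = False" "dm_true dm_b = True" "dm_true dm_top = True"
  "dm_false dm_bot = True" "dm_false dm_n = False" "dm_false dm_b = True" "dm_false dm_top = False"
  by (simp_all add: dm_defs)

lemma dm_true_ops [simp]:
  "dm_true (dm_neg x) = dm_false x" "dm_false (dm_neg x) = dm_true x"
  "dm_true (inf x y) \<longleftrightarrow> dm_true x \<and> dm_true y" "dm_false (inf x y) \<longleftrightarrow> dm_false x \<or> dm_false y"
  "dm_true (sup x y) \<longleftrightarrow> dm_true x \<or> dm_true y" "dm_false (sup x y) \<longleftrightarrow> dm_false x \<and> dm_false y"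
  by (cases x; cases y; simp add: dm_defs)+

text \<open>Carrier and designated set do not affect evaluation, so one function serves every matrix
  over the four-element algebra.\<close>

definition dm_eval :: "(nat \<Rightarrow> dm4) \<Rightarrow> fm \<Rightarrow> dm4" where
  "dm_eval = m_eval (dm_matrix UNIV UNIV)"

lemma dm_eval_simps [simp]:
  "dm_eval v (Var x) = v x" "dm_eval v Top = dm_top" "dm_eval v Bot = dm_bot"
  "dm_eval v (Neg a) = dm_neg (dm_eval v a)"
  "dm_eval v (Conj a b) = inf (dm_eval v a) (dm_eval v b)"
  "dm_eval v (Disj a b) = sup (dm_eval v a) (dm_eval v b)"
  by (simp_all add: dm_eval_def dm_matrix_def top_dm4_def bot_dm4_def)

lemma m_eval_dm_matrix: "m_eval (dm_matrix A D) v a = dm_eval v a"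
  by (induction a) (simp_all add: dm_matrix_def top_dm4_def bot_dm4_def)

lemma dm_eval_subst: "dm_eval v (subst s a) = dm_eval (\<lambda>x. dm_eval v (s x)) a"
  by (simp add: dm_eval_def m_eval_subst)

text \<open>The information order, with \<open>dm_n\<close> at the bottom and \<open>dm_b\<close> at the top.\<close>

definition dm_info :: "dm4 \<Rightarrow> dm4 \<Rightarrow> bool" where
  "dm_info x y \<longleftrightarrow> (dm_true x \<longrightarrow> dm_true y) \<and> (dm_false x \<longrightarrow> dm_false y)"

text \<open>Negation only swaps the bits, so it preserves the information order just as meet and
  join do.\<close>

lemma dm_eval_info_mono:
  "(\<And>x. dm_info (v x) (w x)) \<Longrightarrow> dm_info (dm_eval v a) (dm_eval w a)"
  by (induction a) (auto simp: dm_info_def)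

lemma dm_eval_true_mono:
  "(\<And>x. dm_info (v x) (w x)) \<Longrightarrow> dm_true (dm_eval v a) \<Longrightarrow> dm_true (dm_eval w a)"
  using dm_eval_info_mono unfolding dm_info_def by blast

lemma dm_eval_false_mono:
  "(\<And>x. dm_info (v x) (w x)) \<Longrightarrow> dm_false (dm_eval v a) \<Longrightarrow> dm_false (dm_eval w a)"
  using dm_eval_info_mono unfolding dm_info_def by blast

definition total_val :: "(nat \<Rightarrow> dm4) \<Rightarrow> bool" where
  "total_val v \<longleftrightarrow> (\<forall>x. dm_true (v x) \<or> dm_false (v x))"

text \<open>Compatible pairs \<open>(v, w)\<close> are the valuations into \<open>K_minus_matrix\<close>: the values of \<open>v\<close> record
  membership of \<open>pt_u, pt_u'\<close> and those of \<open>w\<close> membership of \<open>pt_v, pt_v'\<close>. A pair \<open>(v, v)\<close> is compatible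
  iff \<open>v\<close> takes values in the Kleene algebra.\<close>

definition compat_vals :: "(nat \<Rightarrow> dm4) \<Rightarrow> (nat \<Rightarrow> dm4) \<Rightarrow> bool" where
  "compat_vals v w \<longleftrightarrow> (\<forall>x. \<not> (dm_true (v x) \<and> dm_false (v x)) \<and>
     \<not> (dm_true (v x) \<and> dm_false (w x)) \<and> \<not> (dm_false (v x) \<and> dm_true (w x)))"

lemma total_val_eval: "total_val v \<Longrightarrow> dm_true (dm_eval v a) \<or> dm_false (dm_eval v a)"
  by (induction a) (auto simp: total_val_def)

lemma compat_vals_eval:
  assumes "compat_vals v w"
  shows "\<not> (dm_true (dm_eval v a) \<and> dm_false (dm_eval v a)) \<and>
     \<not> (dm_true (dm_eval v a) \<and> dm_false (dm_eval w a)) \<and>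
     \<not> (dm_false (dm_eval v a) \<and> dm_true (dm_eval w a))"
  by (induction a) (use assms in \<open>auto simp: compat_vals_def\<close>)

section \<open>Validity in the given logics, expressed through the bits\<close>

lemma BD_iff:
  "(G, a) \<in> BD \<longleftrightarrow> (\<forall>v. (\<forall>g\<in>G. dm_true (dm_eval v g)) \<longrightarrow> dm_true (dm_eval v a))"
  unfolding BD_def Log_def m_valid_def m_eval_dm_matrix
  by (simp add: dm_matrix_def image_subset_iff dm_true_def)

lemma LP_iff:
  "(G, a) \<in> LP \<longleftrightarrow>
     (\<forall>v. total_val v \<longrightarrow> (\<forall>g\<in>G. dm_true (dm_eval v g)) \<longrightarrow> dm_true (dm_eval v a))"
proof -
  have "range v \<subseteq> {dm_bot, dm_b, dm_top} \<longleftrightarrow> total_val v" for v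
    by (auto simp: total_val_def image_subset_iff dm_defs)
  then show ?thesis
    unfolding LP_def Log_def m_valid_def m_eval_dm_matrix
    by (simp add: dm_matrix_def image_subset_iff dm_true_def)
qed

text \<open>In the absence of \<open>dm_b\<close>, designating \<open>dm_top\<close> alone amounts
  to designating truth.\<close>

lemma eq_dm_top_iff:
  "compat_vals v v \<Longrightarrow> dm_eval v a = dm_top \<longleftrightarrow> dm_true (dm_eval v a)"
  using compat_vals_eval[of v v a] by (auto simp: dm_eq_iff)

lemma K_iff:
  "(G, a) \<in> K \<longleftrightarrow>
     (\<forall>v. compat_vals v v \<longrightarrow> (\<forall>g\<in>G. dm_true (dm_eval v g)) \<longrightarrow> dm_true (dm_eval v a))"
proof -
  have "v x \<in> {dm_bot, dm_n, dm_top} \<longleftrightarrow> \<not> (dm_true (v x) \<and> dm_false (v x))"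
    for v :: "nat \<Rightarrow> dm4" and x
    by (cases "v x") auto
  then have "range v \<subseteq> {dm_bot, dm_n, dm_top} \<longleftrightarrow> compat_vals v v" for v
    by (auto simp: compat_vals_def image_subset_iff)
  then show ?thesis
    unfolding K_def Log_def m_valid_def m_eval_dm_matrix
    by (simp add: dm_matrix_def image_subset_iff eq_dm_top_iff cong: imp_cong)
qed

lemma CL_iff:
  "(G, a) \<in> CL \<longleftrightarrow> (\<forall>v. compat_vals v v \<longrightarrow> total_val v \<longrightarrow>
     (\<forall>g\<in>G. dm_true (dm_eval v g)) \<longrightarrow> dm_true (dm_eval v a))"
proof -
  have "v x \<in> {dm_bot, dm_top} \<longleftrightarrow>
      \<not> (dm_true (v x) \<and> dm_false (v x)) \<and> (dm_true (v x) \<or> dm_false (v x))"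
    for v :: "nat \<Rightarrow> dm4" and x
    by (cases "v x") auto
  then have "range v \<subseteq> {dm_bot, dm_top} \<longleftrightarrow> compat_vals v v \<and> total_val v" for v
    by (auto simp: compat_vals_def total_val_def image_subset_iff)
  then have "(G, a) \<in> CL \<longleftrightarrow> (\<forall>v. compat_vals v v \<longrightarrow> total_val v \<longrightarrow>
      (\<forall>g\<in>G. dm_eval v g = dm_top) \<longrightarrow> dm_eval v a = dm_top)"
    unfolding CL_def Log_def m_valid_def m_eval_dm_matrix
    by (simp add: dm_matrix_def image_subset_iff) blast
  then show ?thesis
    by (simp add: eq_dm_top_iff cong: imp_cong)
qed

definition dm_bits :: "bool \<Rightarrow> bool \<Rightarrow> dm4" where
  "dm_bits t f = (if t then if f then dm_b else dm_top else if f then dm_bot else dm_n)"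

lemma dm_bits_simps [simp]: "dm_true (dm_bits t f) = t" "dm_false (dm_bits t f) = f"
  by (simp_all add: dm_bits_def)

lemma pt_inv_image_iff: "x \<in> pt_inv ` U \<longleftrightarrow> pt_inv x \<in> U"
proof -
  have "pt_inv (pt_inv y) = y" for y by (cases y) simp_all
  then show ?thesis by (metis image_iff)
qed

text \<open>On each orbit of the involution the unprimed point records truth and absence of its
  primed partner records falsity. Complementing the image under the involution swaps these bits, so
  evaluation runs in two copies of the four-element algebra.\<close>

lemma m_eval_K_minus:
  assumes "\<And>x. pt_u \<in> V x \<longleftrightarrow> dm_true (v x)" "\<And>x. pt_u' \<in> V x \<longleftrightarrow> \<not> dm_false (v x)"
    "\<And>x. pt_v \<in> V x \<longleftrightarrow> dm_true (w x)" "\<And>x. pt_v' \<in> V x \<longleftrightarrow> \<not> dm_false (w x)"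
  shows "(pt_u \<in> m_eval K_minus_matrix V a \<longleftrightarrow> dm_true (dm_eval v a)) \<and>
    (pt_u' \<in> m_eval K_minus_matrix V a \<longleftrightarrow> \<not> dm_false (dm_eval v a)) \<and>
    (pt_v \<in> m_eval K_minus_matrix V a \<longleftrightarrow> dm_true (dm_eval w a)) \<and>
    (pt_v' \<in> m_eval K_minus_matrix V a \<longleftrightarrow> \<not> dm_false (dm_eval w a))"
  by (induction a) (auto simp: K_minus_matrix_def assms pt_inv_image_iff)

lemma UNIV_pt: "UNIV = {pt_u, pt_v, pt_u', pt_v'}"
proof -
  have "x \<in> {pt_u, pt_v, pt_u', pt_v'}" for x by (cases x) simp_all
  then show ?thesis by blast
qed

lemma pt_UNIV_iff: "U = UNIV \<longleftrightarrow> pt_u \<in> U \<and> pt_v \<in> U \<and> pt_u' \<in> U \<and> pt_v' \<in> U"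
  unfolding set_eq_iff by (auto intro: pt.induct[of "\<lambda>p. p \<in> U"])

lemma pt_upsets_iff: "U \<in> pt_upsets \<longleftrightarrow>
    (pt_u \<in> U \<longrightarrow> pt_u' \<in> U) \<and> (pt_u \<in> U \<longrightarrow> pt_v' \<in> U) \<and> (pt_v \<in> U \<longrightarrow> pt_u' \<in> U)"
  by (auto simp: pt_upsets_def less_eq_pt_def less_pt_def)

text \<open>By compatibility, truth under \<open>v\<close> rules out falsity under both
  \<open>v\<close> and \<open>w\<close>, so the two truth bits already force all four
  points.\<close>

lemma m_eval_K_minus_desig:
  assumes "\<And>x. pt_u \<in> V x \<longleftrightarrow> dm_true (v x)" "\<And>x. pt_u' \<in> V x \<longleftrightarrow> \<not> dm_false (v x)"
    "\<And>x. pt_v \<in> V x \<longleftrightarrow> dm_true (w x)" "\<And>x. pt_v' \<in> V x \<longleftrightarrow> \<not> dm_false (w x)"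
    and "compat_vals v w"
  shows "m_eval K_minus_matrix V a \<in> m_desig K_minus_matrix \<longleftrightarrow>
    dm_true (dm_eval v a) \<and> dm_true (dm_eval w a)"
  using m_eval_K_minus[where a = a, OF assms(1-4)] compat_vals_eval[OF assms(5), of a]
  by (auto simp: K_minus_matrix_def pt_UNIV_iff)

text \<open>The three conditions of compatibility are the three strict order relations of the poset,
  so upset-valued valuations and compatible pairs determine each other.\<close>

lemma K_minus_iff:
  "(G, a) \<in> K_minus \<longleftrightarrow> (\<forall>v w. compat_vals v w \<longrightarrow>
     (\<forall>g\<in>G. dm_true (dm_eval v g) \<and> dm_true (dm_eval w g)) \<longrightarrow>
     dm_true (dm_eval v a) \<and> dm_true (dm_eval w a))" (is "_ \<longleftrightarrow> ?R")
proof
  assume L: "(G, a) \<in> K_minus"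
  show ?R
  proof (intro allI impI)
    fix v w assume c: "compat_vals v w"
      and G: "\<forall>g\<in>G. dm_true (dm_eval v g) \<and> dm_true (dm_eval w g)"
    define V where "V x = {p. case p of pt_u \<Rightarrow> dm_true (v x) | pt_u' \<Rightarrow> \<not> dm_false (v x)
      | pt_v \<Rightarrow> dm_true (w x) | pt_v' \<Rightarrow> \<not> dm_false (w x)}" for x
    have "range V \<subseteq> m_carrier K_minus_matrix"
      using c by (auto simp: K_minus_matrix_def pt_upsets_iff V_def compat_vals_def)
    moreover have desig: "m_eval K_minus_matrix V b \<in> m_desig K_minus_matrix \<longleftrightarrow>
        dm_true (dm_eval v b) \<and> dm_true (dm_eval w b)" for b
      by (rule m_eval_K_minus_desig) (simp_all add: V_def c)
    ultimately show "dm_true (dm_eval v a) \<and> dm_true (dm_eval w a)"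
      using L G unfolding K_minus_def Log_def m_valid_def by (simp add: image_subset_iff) blast
  qed
next
  assume R: ?R
  have "m_eval K_minus_matrix V a \<in> m_desig K_minus_matrix"
    if V: "range V \<subseteq> m_carrier K_minus_matrix"
      and G: "m_eval K_minus_matrix V ` G \<subseteq> m_desig K_minus_matrix" for V
  proof -
    define v where "v x = dm_bits (pt_u \<in> V x) (pt_u' \<notin> V x)" for x
    define w where "w x = dm_bits (pt_v \<in> V x) (pt_v' \<notin> V x)" for x
    have "V x \<in> pt_upsets" for x
      using V by (auto simp: K_minus_matrix_def)
    then have c: "compat_vals v w"
      unfolding compat_vals_def v_def w_def pt_upsets_iff by auto
    have desig: "m_eval K_minus_matrix V b \<in> m_desig K_minus_matrix \<longleftrightarrow>
        dm_true (dm_eval v b) \<and> dm_true (dm_eval w b)" for b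
      by (rule m_eval_K_minus_desig[OF _ _ _ _ c]) (simp_all add: v_def w_def)
    show ?thesis
      using R c G by (simp add: desig image_subset_iff)
  qed
  then show "(G, a) \<in> K_minus"
    by (auto simp: K_minus_def Log_def m_valid_def)
qed

lemma KO_minus_iff: "(G, a) \<in> KO_minus \<longleftrightarrow> (G, a) \<in> LP \<and> (G, a) \<in> K_minus"
  by (simp add: KO_minus_def)

section \<open>Logics and their inclusions\<close>

lemma is_logic_member:
  assumes "is_logic L" "a \<in> G" shows "(G, a) \<in> L"
  using is_logic_mono[OF assms(1) is_logic_refl[OF assms(1)], of a G] assms(2)
  by (simp add: insert_absorb)

lemma is_logic_weaken: "is_logic L \<Longrightarrow> (G, a) \<in> L \<Longrightarrow> G \<subseteq> H \<Longrightarrow> (H, a) \<in> L"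
  using is_logic_mono[of L G a H] by (simp add: sup.absorb2)

lemma is_logic_trans:
  assumes "is_logic L" "(D, a) \<in> L" "\<And>d. d \<in> D \<Longrightarrow> (G, d) \<in> L"
  shows "(G, a) \<in> L"
  using is_logic_cut[OF assms(1) assms(3)] is_logic_weaken[OF assms(1,2), of "G \<union> D"] by blast

section \<open>The given matrices define logics\<close>

lemma is_logic_Log:
  assumes "\<And>v a. range v \<subseteq> m_carrier M \<Longrightarrow> m_eval M v a \<in> m_carrier M"
  shows "is_logic (Log M)"
  unfolding is_logic_def
proof (intro conjI allI impI)
  show "(subst s ` G, subst s a) \<in> Log M" if G: "(G, a) \<in> Log M" for s G a
  proof -
    have "m_eval M v (subst s a) \<in> m_desig M"
      if v: "range v \<subseteq> m_carrier M" "m_eval M v ` subst s ` G \<subseteq> m_desig M" for v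
    proof -
      have "range (\<lambda>x. m_eval M v (s x)) \<subseteq> m_carrier M"
        using assms[OF v(1)] by blast
      with G v(2) show ?thesis
        by (simp add: Log_def m_valid_def m_eval_subst image_image)
    qed
    then show ?thesis by (simp add: Log_def m_valid_def)
  qed
next
  show "(G, a) \<in> Log M" if "\<forall>d\<in>D. (G, d) \<in> Log M" "(G \<union> D, a) \<in> Log M" for G D a
    using that by (simp add: Log_def m_valid_def image_subset_iff) blast
qed (simp_all add: Log_def m_valid_def image_Un)

lemma m_eval_dm_matrix_closed:
  assumes "range v \<subseteq> A" "dm_bot \<in> A" "dm_top \<in> A"
    "A \<subseteq> {dm_bot, dm_n, dm_top} \<or> A \<subseteq> {dm_bot, dm_b, dm_top}"
  shows "m_eval (dm_matrix A D) v a \<in> A"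
proof -
  have neg: "dm_neg x \<in> A" if "x \<in> A" for x
    using assms(2-) that by (cases x) auto
  have "inf x y = x \<or> inf x y = y \<or> inf x y = dm_bot"
    "sup x y = x \<or> sup x y = y \<or> sup x y = dm_top" for x y :: dm4
    by (simp_all add: inf_dm4_def sup_dm4_def)
  then have ops: "inf x y \<in> A" "sup x y \<in> A" if "x \<in> A" "y \<in> A" for x y
    using assms(2,3) that by metis+
  show ?thesis
    unfolding m_eval_dm_matrix by (induction a) (use assms(1-3) in \<open>auto simp: neg ops\<close>)
qed

lemma is_logic_dm_matrix:
  assumes "dm_bot \<in> A" "dm_top \<in> A" "A \<subseteq> {dm_bot, dm_n, dm_top} \<or> A \<subseteq> {dm_bot, dm_b, dm_top}"
  shows "is_logic (Log (dm_matrix A D))"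
proof (rule is_logic_Log)
  have carrier: "m_carrier (dm_matrix A D) = A" by (simp add: dm_matrix_def)
  show "m_eval (dm_matrix A D) v a \<in> m_carrier (dm_matrix A D)"
    if "range v \<subseteq> m_carrier (dm_matrix A D)" for v a
    using m_eval_dm_matrix_closed[OF _ assms] that unfolding carrier .
qed

lemma is_logic_LP: "is_logic LP"
  unfolding LP_def by (rule is_logic_dm_matrix) simp_all

lemma is_logic_K: "is_logic K"
  unfolding K_def by (rule is_logic_dm_matrix) simp_all

lemma is_logic_CL: "is_logic CL"
  unfolding CL_def by (rule is_logic_dm_matrix) simp_all

lemma is_logic_K_minus: "is_logic K_minus"
  unfolding K_minus_def
proof (rule is_logic_Log)
  fix v :: "nat \<Rightarrow> pt set" and a assume v: "range v \<subseteq> m_carrier K_minus_matrix"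
  show "m_eval K_minus_matrix v a \<in> m_carrier K_minus_matrix"
  proof (induction a)
    case (Neg a)
    then show ?case using pt_upsets_neg by (simp add: K_minus_matrix_def)
  qed (use v in \<open>auto simp: K_minus_matrix_def pt_upsets_def\<close>)
qed

lemma is_logic_Int:
  assumes L: "is_logic L1" "is_logic L2"
  shows "is_logic (L1 \<inter> L2)"
  unfolding is_logic_def Int_iff
proof (intro conjI allI impI)
  fix G D a
  assume D: "\<forall>d\<in>D. (G, d) \<in> L1 \<and> (G, d) \<in> L2" and a: "(G \<union> D, a) \<in> L1 \<and> (G \<union> D, a) \<in> L2"
  show "(G, a) \<in> L1" by (rule is_logic_cut[OF L(1), of D]) (use D a in auto)
  show "(G, a) \<in> L2" by (rule is_logic_cut[OF L(2), of D]) (use D a in auto)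
qed (auto intro: is_logic_refl is_logic_mono is_logic_subst L)

section \<open>Inclusions and finitarity of the given logics\<close>

lemma BD_subset_LP: "BD \<subseteq> LP"
  by (auto simp: BD_iff LP_iff)

lemma BD_subset_K_minus: "BD \<subseteq> K_minus"
  by (auto simp: BD_iff K_minus_iff)

lemma K_minus_subset_K: "K_minus \<subseteq> K"
  by (auto simp: K_iff K_minus_iff)

lemma K_subset_CL: "K \<subseteq> CL"
  by (auto simp: K_iff CL_iff)

lemma LP_subset_CL: "LP \<subseteq> CL"
  by (auto simp: LP_iff CL_iff)

lemma BD_subset_KO_minus: "BD \<subseteq> KO_minus"
  using BD_subset_LP BD_subset_K_minus by (simp add: KO_minus_def)

lemma finitary_K: "finitary K"
  unfolding K_def by (rule finitary_Log) (simp add: dm_matrix_def)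

lemma finitary_CL: "finitary CL"
  unfolding CL_def by (rule finitary_Log) (simp add: dm_matrix_def)

lemma finitary_K_minus: "finitary K_minus"
  unfolding K_minus_def
proof (rule finitary_Log)
  have "finite (UNIV :: pt set)" by (simp add: UNIV_pt)
  then have "finite (UNIV :: pt set set)" by (simp add: Finite_Set.finite_set)
  then show "finite (m_carrier K_minus_matrix)" by (rule finite_subset[OF subset_UNIV])
qed

section \<open>Excluded middle and the Kleene rule\<close>

text \<open>Adding excluded middle for every variable as a premise makes each model total, which
  turns an \<open>LP\<close> consequence into a \<open>BD\<close> consequence. Cut removes the
  infinitely many added premises.\<close>

lemma LP_subset_of_excluded_middle:
  assumes L: "is_logic L" and BD: "BD \<subseteq> L" and em: "({}, Disj (Var 0) (Neg (Var 0))) \<in> L"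
  shows "LP \<subseteq> L"
proof (rule subrelI)
  fix G a assume "(G, a) \<in> LP"
  then have "(G \<union> range (\<lambda>x. Disj (Var x) (Neg (Var x))), a) \<in> BD"
    by (auto simp: LP_iff BD_iff total_val_def ball_Un)
  with BD have "(G \<union> range (\<lambda>x. Disj (Var x) (Neg (Var x))), a) \<in> L" ..
  moreover have "(G, Disj (Var x) (Neg (Var x))) \<in> L" for x
    using is_logic_weaken[OF L is_logic_subst[OF L em, of "\<lambda>_. Var x"], of G] by simp
  then have "(G, d) \<in> L" if "d \<in> G \<union> range (\<lambda>x. Disj (Var x) (Neg (Var x)))" for d
    using that is_logic_member[OF L] by auto
  ultimately show "(G, a) \<in> L"
    by (rule is_logic_trans[OF L])
qed

lemma LP_subset_of_not_subset_K:
  assumes L: "is_logic L" and BD: "BD \<subseteq> L" and "\<not> L \<subseteq> K"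
  shows "LP \<subseteq> L"
proof -
  from \<open>\<not> L \<subseteq> K\<close> obtain G a where Ga: "(G, a) \<in> L" "(G, a) \<notin> K" by auto
  then obtain v where v: "compat_vals v v" "\<And>g. g \<in> G \<Longrightarrow> dm_true (dm_eval v g)"
    "\<not> dm_true (dm_eval v a)"
    by (auto simp: K_iff)
  \<comment> \<open>The gap \<open>dm_n\<close> becomes \<open>Var 0\<close> and the classical
    values become constants. Every valuation then yields at least the information of
    \<open>v\<close>, so the premise instances are theorems; a gap at \<open>Var 0\<close> recovers
    \<open>v\<close> exactly and refutes the conclusion.\<close>
  define s where "s x = (if dm_true (v x) then Top else if dm_false (v x) then Bot else Var 0)" for x
  have info: "dm_info (v x) (dm_eval w (s x))" for w x
    using v(1) by (auto simp: s_def dm_info_def compat_vals_def)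
  have eq: "dm_eval w (s x) = v x" if "w 0 = dm_n" for w x
    using v(1) that by (auto simp: s_def dm_eq_iff compat_vals_def)
  have "({}, subst s g) \<in> BD" if "g \<in> G" for g
    using dm_eval_true_mono[OF info] v(2)[OF that] by (simp add: BD_iff dm_eval_subst)
  then have "({}, subst s a) \<in> L"
    using is_logic_trans[OF L is_logic_subst[OF L Ga(1)]] BD by blast
  moreover have "({subst s a}, Disj (Var 0) (Neg (Var 0))) \<in> BD"
    unfolding BD_iff
  proof (intro allI impI)
    fix w assume "\<forall>g\<in>{subst s a}. dm_true (dm_eval w g)"
    then have "w 0 \<noteq> dm_n" using v(3) by (auto simp: dm_eval_subst eq)
    then show "dm_true (dm_eval w (Disj (Var 0) (Neg (Var 0))))" by (auto simp: dm_eq_iff)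
  qed
  ultimately have "({}, Disj (Var 0) (Neg (Var 0))) \<in> L"
    using BD is_logic_trans[OF L] by blast
  then show ?thesis by (rule LP_subset_of_excluded_middle[OF L BD])
qed

text \<open>The side disjunct \<open>Var 1\<close> allows the rule to be applied to one disjunct of
  a longer disjunction.\<close>

definition kleene_rule :: rule where
  "kleene_rule = ({Disj (Conj (Var 0) (Neg (Var 0))) (Var 1)},
     Disj (Var 1) (Disj (Var 2) (Neg (Var 2))))"

lemma kleene_rule_instance:
  assumes "is_logic L" "kleene_rule \<in> L"
  shows "({Disj (Conj a (Neg a)) b}, Disj b (Disj c (Neg c))) \<in> L"
  using is_logic_subst[OF assms(1) assms(2)[unfolded kleene_rule_def],
      of "\<lambda>x. if x = 0 then a else if x = 1 then b else c"]
  by simp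

definition gluts :: "nat list \<Rightarrow> fm \<Rightarrow> fm" where
  "gluts xs a = foldr (\<lambda>x. Disj (Conj (Var x) (Neg (Var x)))) xs a"

lemma gluts_simps [simp]:
  "gluts [] a = a" "gluts (x # xs) a = Disj (Conj (Var x) (Neg (Var x))) (gluts xs a)"
  by (simp_all add: gluts_def)

lemma dm_true_gluts:
  "dm_true (dm_eval v (gluts xs a)) \<longleftrightarrow>
     (\<exists>x\<in>set xs. dm_true (v x) \<and> dm_false (v x)) \<or> dm_true (dm_eval v a)"
  by (induction xs) auto

text \<open>The rule removes the first glut with the remaining disjunction as side formula. The
  resulting excluded middle is moved inside, next to \<open>a\<close>, for the induction hypothesis,
  and the duplicate copy is absorbed at the end.\<close>

lemma eliminate_gluts:
  assumes L: "is_logic L" and BD: "BD \<subseteq> L" and rule: "kleene_rule \<in> L"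
  shows "({gluts xs a}, Disj a (Disj (Var x) (Neg (Var x)))) \<in> L"
proof (induction xs arbitrary: a)
  case Nil
  have "({a}, Disj a (Disj (Var x) (Neg (Var x)))) \<in> BD" by (simp add: BD_iff)
  with BD show ?case by auto
next
  case (Cons y ys)
  let ?e = "Disj (Var x) (Neg (Var x))"
  have "({gluts (y # ys) a}, Disj (gluts ys a) ?e) \<in> L"
    using kleene_rule_instance[OF L rule] by simp
  moreover have "({Disj (gluts ys a) ?e}, gluts ys (Disj a ?e)) \<in> BD"
    by (auto simp: BD_iff dm_true_gluts)
  ultimately have "({gluts (y # ys) a}, gluts ys (Disj a ?e)) \<in> L"
    using BD is_logic_trans[OF L] by blast
  then have "({gluts (y # ys) a}, Disj (Disj a ?e) ?e) \<in> L"
    using is_logic_trans[OF L Cons.IH[of "Disj a ?e"]] by blast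
  moreover have "({Disj (Disj a ?e) ?e}, Disj a ?e) \<in> BD"
    by (auto simp: BD_iff)
  ultimately show ?case
    using BD is_logic_trans[OF L] by blast
qed

lemma dm_eval_cong: "(\<And>x. x \<in> fm_vars a \<Longrightarrow> v x = w x) \<Longrightarrow> dm_eval v a = dm_eval w a"
  unfolding dm_eval_def by (rule m_eval_cong)

text \<open>Validity in \<open>K\<close> gives the conclusion up to gluts among the variables of
  finitely many premises. The rule trades these gluts for excluded middle of an arbitrary variable,
  which validity in \<open>LP\<close> then eliminates.\<close>

lemma KO_subset_of_kleene_rule:
  assumes L: "is_logic L" and BD: "BD \<subseteq> L" and rule: "kleene_rule \<in> L"
  shows "KO \<subseteq> L"
proof (rule subrelI)
  fix G a assume Ga: "(G, a) \<in> KO"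
  then obtain G0 where G0: "G0 \<subseteq> G" "finite G0" "(G0, a) \<in> K"
    using finitary_K unfolding finitary_def KO_def by blast
  have "finite (\<Union>(fm_vars ` G0))" using G0(2) by (simp add: finite_fm_vars)
  from finite_list[OF this] obtain xs where xs: "set xs = \<Union>(fm_vars ` G0)" ..
  have "(G0, gluts xs a) \<in> BD"
    unfolding BD_iff dm_true_gluts
  proof (intro allI impI)
    fix v assume v: "\<forall>g\<in>G0. dm_true (dm_eval v g)"
    show "(\<exists>x\<in>set xs. dm_true (v x) \<and> dm_false (v x)) \<or> dm_true (dm_eval v a)"
    proof (rule disjCI)
      assume na: "\<not> dm_true (dm_eval v a)"
      \<comment> \<open>Gluts are lowered to gaps. This cannot make the conclusion true, so by
        \<open>K\<close> some premise loses its truth and must contain a variable that was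
        changed.\<close>
      define w where "w x = (if v x = dm_b then dm_n else v x)" for x
      have w: "compat_vals w w" by (auto simp: compat_vals_def w_def dm_eq_iff)
      have "dm_info (w x) (v x)" for x by (simp add: w_def dm_info_def)
      with na have "\<not> dm_true (dm_eval w a)" using dm_eval_true_mono by blast
      with G0(3) w obtain g where g: "g \<in> G0" "\<not> dm_true (dm_eval w g)"
        by (auto simp: K_iff)
      with v have "dm_eval w g \<noteq> dm_eval v g" by auto
      then obtain x where "x \<in> fm_vars g" "w x \<noteq> v x" using dm_eval_cong by metis
      then have "x \<in> set xs" "v x = dm_b" using g(1) xs by (auto simp: w_def split: if_splits)
      then show "\<exists>x\<in>set xs. dm_true (v x) \<and> dm_false (v x)"
        by (intro bexI[of _ x]) simp_all
    qed
  qed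
  then have "(G, gluts xs a) \<in> L" using BD is_logic_weaken[OF L _ G0(1)] by blast
  then have em: "(G, Disj a (Disj (Var x) (Neg (Var x)))) \<in> L" for x
    using is_logic_trans[OF L eliminate_gluts[OF L BD rule]] by blast
  \<comment> \<open>A valuation satisfying all these disjunctions either makes \<open>a\<close> true
    or is total.\<close>
  have "(G \<union> range (\<lambda>x. Disj a (Disj (Var x) (Neg (Var x)))), a) \<in> BD"
    using Ga by (auto simp: KO_def LP_iff BD_iff total_val_def ball_Un)
  with BD have "(G \<union> range (\<lambda>x. Disj a (Disj (Var x) (Neg (Var x)))), a) \<in> L" ..
  then show "(G, a) \<in> L"
    by (rule is_logic_trans[OF L]) (use em is_logic_member[OF L] in auto)
qed

text \<open>A refuting pair is coded by terms in two variables. Relative to \<open>KO_minus\<close>,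
  the premise instances follow from the premise of the Kleene rule, and that premise together with
  the conclusion instance gives the conclusion of the Kleene rule.\<close>

lemma KO_subset_of_not_subset_K_minus:
  assumes L: "is_logic L" and KO_minus: "KO_minus \<subseteq> L" and "\<not> L \<subseteq> K_minus"
  shows "KO \<subseteq> L"
proof -
  from \<open>\<not> L \<subseteq> K_minus\<close> obtain G a where Ga: "(G, a) \<in> L" "(G, a) \<notin> K_minus" by auto
  then obtain v w where vw: "compat_vals v w"
    and G: "\<And>g. g \<in> G \<Longrightarrow> dm_true (dm_eval v g) \<and> dm_true (dm_eval w g)"
    and a: "\<not> (dm_true (dm_eval v a) \<and> dm_true (dm_eval w a))"
    by (auto simp: K_minus_iff)
  \<comment> \<open>\<open>K_minus_matrix\<close> is generated by \<open>(dm_n, dm_b)\<close> and \<open>(dm_top, dm_n)\<close>, the values of \<open>p\<close> and \<open>q\<close>.\<close>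
  let ?p = "Var 0" and ?q = "Var 1"
  let ?X = "Disj (Conj ?p (Neg ?p)) ?q" and ?Y = "Disj ?q (Disj (Var 2) (Neg (Var 2)))"
  define s where "s x =
    (if dm_true (v x) then if dm_true (w x) then Top else ?q
     else if dm_false (v x) then if dm_false (w x) then Bot else Neg ?q
     else if dm_true (w x) then if dm_false (w x) then ?p else Disj ?p (Neg ?q)
     else if dm_false (w x) then Conj ?p ?q else Disj (Conj ?p ?q) (Neg ?q))" for x
  have vw_x: "\<not> (dm_true (v x) \<and> dm_false (v x))" "\<not> (dm_true (v x) \<and> dm_false (w x))"
    "\<not> (dm_false (v x) \<and> dm_true (w x))" for x
    using vw by (auto simp: compat_vals_def)
  have info_v: "dm_info (v x) (dm_eval v' (s x))" if "dm_true (v' 1)" for v' x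
    using vw_x[of x] that by (auto simp: s_def dm_info_def)
  have info_w: "dm_info (w x) (dm_eval v' (s x))" if "v' 0 = dm_b" "total_val v'" for v' x
    using vw_x[of x] that by (auto simp: s_def dm_info_def total_val_def)
  have eq_v: "dm_eval v' (s x) = v x" if "v' 0 = dm_n" "v' 1 = dm_top" for v' x
    using vw_x[of x] that by (auto simp: s_def dm_eq_iff)
  have eq_w: "dm_eval v' (s x) = w x" if "v' 0 = dm_b" "v' 1 = dm_n" for v' x
    using vw_x[of x] that by (auto simp: s_def dm_eq_iff)
  \<comment> \<open>The component \<open>v'\<close> has no gluts, so it satisfies \<open>?X\<close>
    through \<open>?q\<close>. If \<open>w'\<close> does so through a glut at \<open>?p\<close>
    only, compatibility fixes all four values to the generating ones.\<close>
  have models: "dm_true (v' 1) \<and> dm_true (w' 1) \<or>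
      v' 0 = dm_n \<and> v' 1 = dm_top \<and> w' 0 = dm_b \<and> w' 1 = dm_n"
    if "compat_vals v' w'" "dm_true (dm_eval v' ?X)" "dm_true (dm_eval w' ?X)" for v' w'
    using that by (auto simp: compat_vals_def dm_eq_iff)
  have true_v: "dm_true (dm_eval v' (subst s g))" if "dm_true (v' 1)" "g \<in> G" for v' g
    using dm_eval_true_mono[of v "\<lambda>x. dm_eval v' (s x)" g] info_v[of v'] that G
    by (simp add: dm_eval_subst)
  have true_w: "dm_true (dm_eval v' (subst s g))" if "v' 0 = dm_b" "total_val v'" "g \<in> G" for v' g
    using dm_eval_true_mono[of w "\<lambda>x. dm_eval v' (s x)" g] info_w[of v'] that G
    by (simp add: dm_eval_subst)
  have "({?X}, subst s g) \<in> KO_minus" if g: "g \<in> G" for g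
    unfolding KO_minus_iff
  proof
    show "({?X}, subst s g) \<in> LP"
      unfolding LP_iff
    proof (intro allI impI)
      fix v' assume v': "total_val v'" "\<forall>g\<in>{?X}. dm_true (dm_eval v' g)"
      then consider "dm_true (v' 1)" | "v' 0 = dm_b" by (auto simp: dm_eq_iff)
      then show "dm_true (dm_eval v' (subst s g))"
        by cases (use true_v[OF _ g] true_w[OF _ v'(1) g] in simp_all)
    qed
    show "({?X}, subst s g) \<in> K_minus"
      unfolding K_minus_iff
    proof (intro allI impI)
      fix v' w' assume c: "compat_vals v' w'"
        and X: "\<forall>g\<in>{?X}. dm_true (dm_eval v' g) \<and> dm_true (dm_eval w' g)"
      from X have "dm_true (dm_eval v' ?X)" "dm_true (dm_eval w' ?X)" by simp_all
      from models[OF c this]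
      show "dm_true (dm_eval v' (subst s g)) \<and> dm_true (dm_eval w' (subst s g))"
        by (elim disjE) (use true_v[OF _ g] G[OF g] in \<open>auto simp: dm_eval_subst eq_v eq_w\<close>)
    qed
  qed
  then have Xa: "({?X}, subst s a) \<in> L"
    using is_logic_trans[OF L is_logic_subst[OF L Ga(1)]] KO_minus by blast
  have "({?X, subst s a}, ?Y) \<in> KO_minus"
    unfolding KO_minus_iff
  proof
    show "({?X, subst s a}, ?Y) \<in> LP" by (auto simp: LP_iff total_val_def)
    show "({?X, subst s a}, ?Y) \<in> K_minus"
      unfolding K_minus_iff
    proof (intro allI impI)
      fix v' w' assume c: "compat_vals v' w'"
        and X: "\<forall>g\<in>{?X, subst s a}. dm_true (dm_eval v' g) \<and> dm_true (dm_eval w' g)"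
      have "\<not> (v' 0 = dm_n \<and> v' 1 = dm_top \<and> w' 0 = dm_b \<and> w' 1 = dm_n)"
        using X a by (auto simp: dm_eval_subst eq_v eq_w)
      with models[OF c] X have "dm_true (v' 1) \<and> dm_true (w' 1)" by auto
      then show "dm_true (dm_eval v' ?Y) \<and> dm_true (dm_eval w' ?Y)" by simp
    qed
  qed
  with KO_minus have "({?X, subst s a}, ?Y) \<in> L" ..
  then have "({?X}, ?Y) \<in> L"
    by (rule is_logic_trans[OF L]) (use Xa is_logic_member[OF L] in auto)
  then have "kleene_rule \<in> L" by (simp add: kleene_rule_def)
  moreover have "BD \<subseteq> L" using BD_subset_KO_minus KO_minus by blast
  ultimately show ?thesis by (intro KO_subset_of_kleene_rule[OF L])
qed

section \<open>Explosion\<close>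

definition ecq_rule :: rule where
  "ecq_rule = ({Var 0, Neg (Var 0)}, Var 1)"

lemma ecq_rule_of_not_subset_LP:
  assumes L: "is_logic L" and KO_minus: "KO_minus \<subseteq> L" and "\<not> L \<subseteq> LP"
  shows "ecq_rule \<in> L"
proof -
  from \<open>\<not> L \<subseteq> LP\<close> obtain G a where Ga: "(G, a) \<in> L" "(G, a) \<notin> LP" by auto
  then obtain v where v: "total_val v" and G: "\<And>g. g \<in> G \<Longrightarrow> dm_true (dm_eval v g)"
    and a: "\<not> dm_true (dm_eval v a)"
    by (auto simp: LP_iff)
  define s where "s x =
    (if dm_true (v x) then if dm_false (v x) then Var 0 else Top else Bot)" for x
  have v_x: "dm_true (v x) \<or> dm_false (v x)" for x using v by (simp add: total_val_def)
  have eq: "dm_eval w (s x) = v x" if "w 0 = dm_b" for w x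
    using v_x[of x] that by (auto simp: s_def dm_eq_iff)
  \<comment> \<open>\<open>Var 0\<close> is placed only where \<open>v\<close> has the maximal value
    \<open>dm_b\<close>, so every instance stays below \<open>v\<close>. The conclusion instance is
    therefore never true and entails everything.\<close>
  have info: "dm_info (dm_eval w (s x)) (v x)" for w x
    using v_x[of x] by (auto simp: s_def dm_info_def)
  let ?P = "{Var 0, Neg (Var 0)}"
  have "(?P, subst s g) \<in> KO_minus" if g: "g \<in> G" for g
    unfolding KO_minus_iff
  proof
    show "(?P, subst s g) \<in> LP"
      unfolding LP_iff
    proof (intro allI impI)
      fix w assume "\<forall>g\<in>?P. dm_true (dm_eval w g)"
      then have "w 0 = dm_b" by (simp add: dm_eq_iff)
      then show "dm_true (dm_eval w (subst s g))" using G[OF g] by (simp add: dm_eval_subst eq)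
    qed
    show "(?P, subst s g) \<in> K_minus" by (auto simp: K_minus_iff compat_vals_def)
  qed
  then have Pa: "(?P, subst s a) \<in> L"
    using is_logic_trans[OF L is_logic_subst[OF L Ga(1)]] KO_minus by blast
  have "\<not> dm_true (dm_eval w (subst s a))" for w
    using dm_eval_true_mono[of "\<lambda>x. dm_eval w (s x)" v a] info[of w] a
    by (auto simp: dm_eval_subst)
  then have "({subst s a}, Var 1) \<in> KO_minus"
    by (simp add: KO_minus_iff LP_iff K_minus_iff)
  with KO_minus have "({subst s a}, Var 1) \<in> L" ..
  with Pa show ?thesis
    unfolding ecq_rule_def using is_logic_trans[OF L] by blast
qed

definition conj_list :: "fm list \<Rightarrow> fm" where
  "conj_list xs = foldr Conj xs Top"

lemma dm_true_conj_list: "dm_true (dm_eval v (conj_list xs)) \<longleftrightarrow> (\<forall>g\<in>set xs. dm_true (dm_eval v g))"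
  by (induction xs) (auto simp: conj_list_def)

lemma conj_list_elim_BD: "g \<in> set xs \<Longrightarrow> ({conj_list xs}, g) \<in> BD"
  by (auto simp: BD_iff dm_true_conj_list)

text \<open>Passing to a single premise \<open>b\<close> makes its negation available as a formula,
  as the arguments by explosion and disjunctive syllogism require.\<close>

lemma conj_list_of_finitary:
  assumes L: "is_logic L" and BD: "BD \<subseteq> L" and "finitary L" and "(G, a) \<in> L"
  obtains b where "(G, b) \<in> BD" "({b}, a) \<in> L"
proof -
  obtain G0 where G0: "G0 \<subseteq> G" "finite G0" "(G0, a) \<in> L"
    using assms(3,4) unfolding finitary_def by blast
  from finite_list[OF G0(2)] obtain xs where xs: "set xs = G0" ..
  show thesis
  proof (rule that)
    show "(G, conj_list xs) \<in> BD"
      using xs G0(1) by (auto simp: BD_iff dm_true_conj_list)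
    show "({conj_list xs}, a) \<in> L"
      using is_logic_trans[OF L G0(3)] conj_list_elim_BD[of _ xs] BD xs by blast
  qed
qed

text \<open>Every total valuation lies above a classical one in the information order, and whichever
  disjunct holds classically persists upwards.\<close>

lemma LP_material_implication:
  assumes "({b}, a) \<in> CL"
  shows "({b}, Disj (Neg b) a) \<in> LP"
  unfolding LP_iff
proof (intro allI impI)
  fix v assume v: "total_val v"
  define w where "w x = (if v x = dm_b then dm_top else v x)" for x
  have w: "compat_vals w w" "total_val w"
    using v by (auto simp: w_def compat_vals_def total_val_def dm_eq_iff)
  have info: "dm_info (w x) (v x)" for x by (simp add: w_def dm_info_def)
  have "dm_false (dm_eval w b) \<or> dm_true (dm_eval w a)"
    using assms w total_val_eval[OF w(2), of b] by (auto simp: CL_iff)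
  then show "dm_true (dm_eval v (Disj (Neg b) a))"
    using dm_eval_true_mono[of w v a] dm_eval_false_mono[of w v b] info by auto
qed

lemma CL_refute_K_minus:
  assumes "({b}, Bot) \<in> CL" and v: "compat_vals v w"
  shows "\<not> dm_true (dm_eval v b)"
proof
  assume b: "dm_true (dm_eval v b)"
  \<comment> \<open>This \<open>w\<close> shadows the second component of the pair. It is a
    classical valuation above \<open>v\<close>, to which the truth of \<open>b\<close> would
    persist.\<close>
  define w where "w x = (if v x = dm_n then dm_top else v x)" for x
  have "compat_vals w w" "total_val w"
    using v by (auto simp: w_def compat_vals_def total_val_def dm_eq_iff)
  moreover have "dm_true (dm_eval w b)"
    by (rule dm_eval_true_mono[OF _ b]) (simp add: w_def dm_info_def)
  ultimately show False using assms(1) by (auto simp: CL_iff)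
qed

text \<open>A classically unsatisfiable \<open>b\<close> entails its own negation: in
  \<open>LP\<close> by material implication, and in \<open>K_minus\<close> vacuously. Explosion on
  \<open>b\<close> then gives any conclusion.\<close>

lemma explosion_of_unsatisfiable:
  assumes L: "is_logic L" and KO_minus: "KO_minus \<subseteq> L" and rule: "ecq_rule \<in> L"
    and G: "(G, Bot) \<in> CL"
  shows "(G, a) \<in> L"
proof -
  have "BD \<subseteq> CL" using BD_subset_LP LP_subset_CL by blast
  then obtain b where b: "(G, b) \<in> BD" "({b}, Bot) \<in> CL"
    using conj_list_of_finitary[OF is_logic_CL _ finitary_CL G] by blast
  have "({b}, Disj (Neg b) Bot) \<in> LP" by (rule LP_material_implication[OF b(2)])
  then have "({b}, Neg b) \<in> LP" by (simp add: LP_iff)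
  moreover have "({b}, Neg b) \<in> K_minus" using CL_refute_K_minus[OF b(2)] by (auto simp: K_minus_iff)
  ultimately have neg: "({b}, Neg b) \<in> L" using KO_minus KO_minus_iff by blast
  have "({b, Neg b}, a) \<in> L"
    using is_logic_subst[OF L rule[unfolded ecq_rule_def], of "\<lambda>x. if x = 0 then b else a"] by simp
  then have "({b}, a) \<in> L"
    by (rule is_logic_trans[OF L]) (use neg is_logic_member[OF L] in auto)
  moreover have "(G, b) \<in> L" using b(1) BD_subset_KO_minus KO_minus by blast
  ultimately show ?thesis using is_logic_trans[OF L] by blast
qed

section \<open>Disjunctive syllogism\<close>

definition ds_rule :: rule where
  "ds_rule = ({Var 0, Disj (Neg (Var 0)) (Var 1)}, Var 1)"

text \<open>The substitution codes an \<open>LP\<close> countermodel \<open>v\<close> together with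
  a classical model \<open>w\<close> of the premises. In \<open>LP\<close>, the premises of
  disjunctive syllogism leave two cases: values above \<open>w\<close>, or exactly \<open>v\<close>.
  Both satisfy the premise instances, and the conclusion instance excludes the second case, leaving
  \<open>?q\<close> true.\<close>

lemma ds_rule_of_satisfiable:
  assumes L: "is_logic L" and KO_minus: "KO_minus \<subseteq> L"
    and Ga: "(G, a) \<in> L" "(G, a) \<notin> LP" "(G, Bot) \<notin> CL"
  shows "ds_rule \<in> L"
proof -
  obtain v where v: "total_val v" and Gv: "\<And>g. g \<in> G \<Longrightarrow> dm_true (dm_eval v g)"
    and a: "\<not> dm_true (dm_eval v a)"
    using Ga(2) by (auto simp: LP_iff)
  obtain w where w: "compat_vals w w" "total_val w" and Gw: "\<And>g. g \<in> G \<Longrightarrow> dm_true (dm_eval w g)"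
    using Ga(3) by (auto simp: CL_iff)
  \<comment> \<open>The pairs of values of \<open>v\<close> and \<open>w\<close> are generated by \<open>(dm_b, _)\<close> and \<open>(dm_bot, dm_top)\<close>,
    the values of \<open>p\<close> and \<open>q\<close>.\<close>
  let ?p = "Var 0" and ?q = "Var 1"
  define s where "s x =
    (if dm_true (v x) then
       if dm_false (v x) then if dm_true (w x) then Disj ?p ?q else Conj ?p (Neg ?q)
       else if dm_true (w x) then Top else Neg ?q
     else if dm_true (w x) then ?q else Bot)" for x
  have x: "dm_true (v x) \<or> dm_false (v x)" "dm_false (w x) \<longleftrightarrow> \<not> dm_true (w x)" for x
    using v w by (auto simp: total_val_def compat_vals_def)
  have eq: "dm_eval v' (s x) = v x" if "v' 0 = dm_b" "v' 1 = dm_bot" for v' x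
    using x[of x] that by (auto simp: s_def dm_eq_iff)
  have info: "dm_info (w x) (dm_eval v' (s x))" if "dm_true (v' 0)" "dm_true (v' 1)" for v' x
    using x[of x] that by (auto simp: s_def dm_info_def)
  let ?P = "{?p, Disj (Neg ?p) ?q}"
  have models_LP: "dm_true (v' 0) \<and> dm_true (v' 1) \<or> v' 0 = dm_b \<and> v' 1 = dm_bot"
    if "total_val v'" "\<forall>g\<in>?P. dm_true (dm_eval v' g)" for v'
    using that by (auto simp: total_val_def dm_eq_iff)
  have models_K: "dm_true (v' 0) \<and> dm_true (v' 1) \<and> dm_true (w' 0) \<and> dm_true (w' 1)"
    if "compat_vals v' w'" "\<forall>g\<in>?P. dm_true (dm_eval v' g) \<and> dm_true (dm_eval w' g)" for v' w'
    using that by (auto simp: compat_vals_def)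
  have true: "dm_true (dm_eval v' (subst s g))" if "dm_true (v' 0)" "dm_true (v' 1)" "g \<in> G" for v' g
    using dm_eval_true_mono[of w "\<lambda>x. dm_eval v' (s x)" g] info[of v'] that Gw
    by (simp add: dm_eval_subst)
  have "(?P, subst s g) \<in> KO_minus" if g: "g \<in> G" for g
    unfolding KO_minus_iff
  proof
    show "(?P, subst s g) \<in> LP"
      unfolding LP_iff
    proof (intro allI impI)
      fix v' assume "total_val v'" "\<forall>g\<in>?P. dm_true (dm_eval v' g)"
      then consider "dm_true (v' 0)" "dm_true (v' 1)" | "v' 0 = dm_b" "v' 1 = dm_bot"
        using models_LP by blast
      then show "dm_true (dm_eval v' (subst s g))"
        by cases (use true[OF _ _ g] Gv[OF g] in \<open>simp_all add: dm_eval_subst eq\<close>)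
    qed
    show "(?P, subst s g) \<in> K_minus"
      unfolding K_minus_iff using models_K true[OF _ _ g] by blast
  qed
  then have Pa: "(?P, subst s a) \<in> L"
    using is_logic_trans[OF L is_logic_subst[OF L Ga(1)]] KO_minus by blast
  have "(insert (subst s a) ?P, ?q) \<in> KO_minus"
    unfolding KO_minus_iff
  proof
    show "(insert (subst s a) ?P, ?q) \<in> LP"
      unfolding LP_iff
    proof (intro allI impI)
      fix v' assume v': "total_val v'" "\<forall>g\<in>insert (subst s a) ?P. dm_true (dm_eval v' g)"
      then have "\<not> (v' 0 = dm_b \<and> v' 1 = dm_bot)" using a by (auto simp: dm_eval_subst eq)
      with models_LP v' show "dm_true (dm_eval v' ?q)" by auto
    qed
    show "(insert (subst s a) ?P, ?q) \<in> K_minus"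
      unfolding K_minus_iff
    proof (intro allI impI)
      fix v' w' assume "compat_vals v' w'"
        "\<forall>g\<in>insert (subst s a) ?P. dm_true (dm_eval v' g) \<and> dm_true (dm_eval w' g)"
      with models_K[of v' w'] show "dm_true (dm_eval v' ?q) \<and> dm_true (dm_eval w' ?q)" by simp
    qed
  qed
  with KO_minus have "(insert (subst s a) ?P, ?q) \<in> L" ..
  then have "(?P, ?q) \<in> L"
    by (rule is_logic_trans[OF L]) (use Pa is_logic_member[OF L] in auto)
  then show ?thesis by (simp add: ds_rule_def)
qed

text \<open>From \<open>b\<close> the formula \<open>Disj (Neg b) a\<close> follows in
  \<open>Y\<close> by weakening \<open>a\<close> and in \<open>LP\<close> by classical validity,
  hence in \<open>L\<close>. Disjunctive syllogism then detaches \<open>a\<close>.\<close>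

lemma subset_of_ds_rule:
  assumes L: "is_logic L" and rule: "ds_rule \<in> L" and LY: "LP \<inter> Y \<subseteq> L"
    and Y: "is_logic Y" "BD \<subseteq> Y" "Y \<subseteq> CL" "finitary Y"
  shows "Y \<subseteq> L"
proof (rule subrelI)
  fix G a assume "(G, a) \<in> Y"
  then obtain b where b: "(G, b) \<in> BD" "({b}, a) \<in> Y"
    using conj_list_of_finitary[OF Y(1,2,4)] by blast
  have "({a}, Disj (Neg b) a) \<in> BD" by (simp add: BD_iff)
  then have "({b}, Disj (Neg b) a) \<in> Y"
    using Y(2) b(2) is_logic_trans[OF Y(1)] by blast
  moreover have "({b}, Disj (Neg b) a) \<in> LP"
    using b(2) Y(3) by (auto intro: LP_material_implication)
  ultimately have imp: "({b}, Disj (Neg b) a) \<in> L" using LY by blast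
  have "({b, Disj (Neg b) a}, a) \<in> L"
    using is_logic_subst[OF L rule[unfolded ds_rule_def], of "\<lambda>x. if x = 0 then b else a"] by simp
  then have "({b}, a) \<in> L"
    by (rule is_logic_trans[OF L]) (use imp is_logic_member[OF L] in auto)
  moreover have "(G, b) \<in> L" using b(1) BD_subset_LP Y(2) LY by blast
  ultimately show "(G, a) \<in> L" using is_logic_trans[OF L] by blast
qed

section \<open>The three intervals\<close>

lemma ecq_rule_in_K_minus: "ecq_rule \<in> K_minus"
  by (auto simp: ecq_rule_def K_minus_iff compat_vals_def)

lemma logic_join_ECQ_subset_iff:
  assumes "is_logic L" "BD \<subseteq> L"
  shows "X \<squnion>\<^sub>L ECQ \<subseteq> L \<longleftrightarrow> X \<subseteq> L \<and> ecq_rule \<in> L"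
proof
  assume "X \<squnion>\<^sub>L ECQ \<subseteq> L"
  moreover have "X \<subseteq> X \<squnion>\<^sub>L ECQ" "ECQ \<subseteq> X \<squnion>\<^sub>L ECQ"
    unfolding logic_join_def using least_logic_upper by blast+
  moreover have "ecq_rule \<in> ECQ"
    unfolding ECQ_def logic_extension_def ecq_rule_def using least_logic_upper by blast
  ultimately show "X \<subseteq> L \<and> ecq_rule \<in> L" by blast
next
  assume r: "X \<subseteq> L \<and> ecq_rule \<in> L"
  then have "ECQ \<subseteq> L"
    using least_logic_least[OF assms(1), of "BD \<union> {ecq_rule}"] assms(2)
    by (simp add: ECQ_def logic_extension_def ecq_rule_def)
  with r show "X \<squnion>\<^sub>L ECQ \<subseteq> L"
    unfolding logic_join_def by (intro least_logic_least[OF assms(1)]) simp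
qed

text \<open>This treats the three intervals uniformly, with \<open>Y\<close> being
  \<open>CL\<close>, \<open>K\<close> or \<open>K_minus\<close>. A logic not below \<open>LP\<close>
  contains explosion, and one also not below the join contains disjunctive syllogism.\<close>

lemma logic_interval_LP_Int:
  assumes Y: "is_logic Y" "K_minus \<subseteq> Y" "Y \<subseteq> CL" "finitary Y"
  shows "logic_interval (LP \<inter> Y) Y = {LP \<inter> Y, (LP \<inter> Y) \<squnion>\<^sub>L ECQ, Y}"
proof -
  define J where "J = (LP \<inter> Y) \<squnion>\<^sub>L ECQ"
  have KO_minus: "KO_minus \<subseteq> LP \<inter> Y" using Y(2) by (auto simp: KO_minus_def)
  have BD: "BD \<subseteq> LP \<inter> Y" using BD_subset_KO_minus KO_minus by blast
  have J: "is_logic J" unfolding J_def logic_join_def by (rule is_logic_least_logic)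
  have J_upper: "LP \<inter> Y \<subseteq> J"
    using least_logic_upper[of "LP \<inter> Y \<union> ECQ"] by (simp add: J_def logic_join_def)
  have ecq_J: "ecq_rule \<in> J"
    using logic_join_ECQ_subset_iff[OF J order.trans[OF BD J_upper], of "LP \<inter> Y"]
    by (simp add: J_def)
  have J_Y: "J \<subseteq> Y"
    using logic_join_ECQ_subset_iff[OF Y(1), of "LP \<inter> Y"] BD subsetD[OF Y(2) ecq_rule_in_K_minus]
    by (simp add: J_def)
  have "L \<in> {LP \<inter> Y, J, Y}" if L: "is_logic L" "LP \<inter> Y \<subseteq> L" "L \<subseteq> Y" for L
  proof (cases "L \<subseteq> LP")
    case True
    with L show ?thesis by blast
  next
    case not_LP: False
    have KL: "KO_minus \<subseteq> L" using KO_minus L(2) by blast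
    have "ecq_rule \<in> L" by (rule ecq_rule_of_not_subset_LP[OF L(1) KL not_LP])
    then have JL: "J \<subseteq> L"
      using logic_join_ECQ_subset_iff[OF L(1) order.trans[OF BD L(2)]] L(2) by (simp add: J_def)
    show ?thesis
    proof (cases "L \<subseteq> J")
      case True
      with JL show ?thesis by blast
    next
      case False
      then obtain G a where Ga: "(G, a) \<in> L" "(G, a) \<notin> J" by auto
      then have "(G, a) \<notin> LP" using J_upper L(3) by blast
      \<comment> \<open>Premises without a classical model would already yield \<open>a\<close> in
        \<open>J\<close> by explosion.\<close>
      moreover have "(G, Bot) \<notin> CL"
        using explosion_of_unsatisfiable[OF J _ ecq_J] Ga(2) KO_minus J_upper by blast
      ultimately have "ds_rule \<in> L" by (rule ds_rule_of_satisfiable[OF L(1) KL Ga(1)])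
      then have "Y \<subseteq> L"
        using BD by (intro subset_of_ds_rule[OF L(1) _ L(2) Y(1) _ Y(3,4)]) auto
      with L(3) show ?thesis by blast
    qed
  qed
  moreover have "is_logic (LP \<inter> Y)" by (rule is_logic_Int[OF is_logic_LP Y(1)])
  ultimately show ?thesis
    unfolding logic_interval_def J_def[symmetric] using J J_upper J_Y Y(1) by blast
qed

lemma LP_not_subset_K: "\<not> LP \<subseteq> K"
proof
  have "({}, Disj (Var 0) (Neg (Var 0))) \<in> LP" by (auto simp: LP_iff total_val_def)
  moreover assume "LP \<subseteq> K"
  ultimately have "({}, Disj (Var 0) (Neg (Var 0))) \<in> K" by blast
  moreover have "compat_vals (\<lambda>_. dm_n) (\<lambda>_. dm_n)" by (simp add: compat_vals_def)
  ultimately have "dm_true (dm_eval (\<lambda>_. dm_n) (Disj (Var 0) (Neg (Var 0))))"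
    unfolding K_iff by blast
  then show False by simp
qed

lemma KO_not_subset_K_minus: "\<not> KO \<subseteq> K_minus"
proof
  have "kleene_rule \<in> KO"
    by (auto simp: kleene_rule_def KO_def LP_iff K_iff total_val_def compat_vals_def)
  moreover assume "KO \<subseteq> K_minus"
  ultimately have r: "kleene_rule \<in> K_minus" by blast
  \<comment> \<open>The generating pairs are assigned to the first two variables and a gap in both
    components to \<open>Var 2\<close>, so the conclusion is not true under
    \<open>w\<close>.\<close>
  define v where "v x = (if x = (1::nat) then dm_top else dm_n)" for x
  define w where "w x = (if x = (0::nat) then dm_b else dm_n)" for x
  have "compat_vals v w" by (simp add: compat_vals_def v_def w_def)
  with r[unfolded kleene_rule_def K_minus_iff, rule_format, of v w]
  have "dm_true (dm_eval w (Disj (Var 1) (Disj (Var 2) (Neg (Var 2)))))"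
    by (simp add: v_def w_def)
  then show False by (simp add: w_def)
qed

theorem theorem6p13:
  shows "(\<forall>L \<in> logic_interval KO_minus CL.
            (L \<in> logic_interval LP CL \<and> L \<notin> logic_interval KO K \<and>
               L \<notin> logic_interval KO_minus K_minus) \<or>
            (L \<notin> logic_interval LP CL \<and> L \<in> logic_interval KO K \<and>
               L \<notin> logic_interval KO_minus K_minus) \<or>
            (L \<notin> logic_interval LP CL \<and> L \<notin> logic_interval KO K \<and>
               L \<in> logic_interval KO_minus K_minus)) \<and>
         logic_interval LP CL = {LP, LP \<squnion>\<^sub>L ECQ, CL} \<and>
         logic_interval KO K = {KO, KO \<squnion>\<^sub>L ECQ, K} \<and>
         logic_interval KO_minus K_minus = {KO_minus, KO_minus \<squnion>\<^sub>L ECQ, K_minus}"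
proof (intro conjI ballI)
  fix L assume "L \<in> logic_interval KO_minus CL"
  then have L: "is_logic L" "KO_minus \<subseteq> L" "L \<subseteq> CL" by (auto simp: logic_interval_def)
  \<comment> \<open>Two dichotomies locate \<open>L\<close>: it is above \<open>LP\<close> or below
    \<open>K\<close>, and above \<open>KO\<close> or below \<open>K_minus\<close>. As
    \<open>K_minus\<close> lies below \<open>K\<close>, the non-inclusions that follow make the
    three cases exclusive.\<close>
  have "LP \<subseteq> L \<or> L \<subseteq> K"
    using LP_subset_of_not_subset_K[OF L(1)] BD_subset_KO_minus L(2) by blast
  moreover have "KO \<subseteq> L \<or> L \<subseteq> K_minus"
    using KO_subset_of_not_subset_K_minus[OF L(1,2)] by blast
  moreover have "\<not> (LP \<subseteq> L \<and> L \<subseteq> K)" using LP_not_subset_K by blast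
  moreover have "\<not> (KO \<subseteq> L \<and> L \<subseteq> K_minus)" using KO_not_subset_K_minus by blast
  ultimately show "(L \<in> logic_interval LP CL \<and> L \<notin> logic_interval KO K \<and>
               L \<notin> logic_interval KO_minus K_minus) \<or>
            (L \<notin> logic_interval LP CL \<and> L \<in> logic_interval KO K \<and>
               L \<notin> logic_interval KO_minus K_minus) \<or>
            (L \<notin> logic_interval LP CL \<and> L \<notin> logic_interval KO K \<and>
               L \<in> logic_interval KO_minus K_minus)"
    unfolding logic_interval_def mem_Collect_eq using L K_minus_subset_K by blast
next
  have "LP \<inter> CL = LP" using LP_subset_CL by blast
  then show "logic_interval LP CL = {LP, LP \<squnion>\<^sub>L ECQ, CL}"
    using logic_interval_LP_Int[OF is_logic_CL _ order_refl finitary_CL] K_minus_subset_K K_subset_CL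
    by simp
  show "logic_interval KO K = {KO, KO \<squnion>\<^sub>L ECQ, K}"
    unfolding KO_def
    by (rule logic_interval_LP_Int[OF is_logic_K K_minus_subset_K K_subset_CL finitary_K])
  show "logic_interval KO_minus K_minus = {KO_minus, KO_minus \<squnion>\<^sub>L ECQ, K_minus}"
    unfolding KO_minus_def
    using K_minus_subset_K K_subset_CL
    by (intro logic_interval_LP_Int[OF is_logic_K_minus _ _ finitary_K_minus]) auto
qed

end
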